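(* Let $d\ge2$, $X=\{0,\dots,d-1\}$, let $\mu$ be the uniform Bernoulli measure on $X^{\mathbb{N}}$, and let $E_2=X^*\{0,d-1\}^{\mathbb{N}}\setminus\operatorname{Cof}((d-1)^{\mathbb{N}})$ and $E_1=X^{\mathbb{N}}\setminus E_2$. If $d=2$, then $\mu(E_1)=0$ and $\mu(E_2)=1$. If $d\ge3$, then $\mu(E_1)=1$ and $\mu(E_2)=0$.
   Context: $X^*$ is the set of finite words over $X$ and $X^{\mathbb{N}}$ the set of infinite words. $X^*\{0,d-1\}^{\mathbb{N}}$ is the set of words $w\zeta$ with $w\in X^*$ and $\zeta\in\{0,d-1\}^{\mathbb{N}}$. $\operatorname{Cof}(\xi)$ is the set of infinite words differing from $\xi$ in finitely many letters, and $(d-1)^{\mathbb{N}}$ is the constant word. $\mu$ is the product of the uniform probability measures on $X$, i.e. $\mu(wX^{\mathbb{N}})=d^{-|w|}$ for $w\in X^*$. *)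

theory Defs
  imports "HOL-Probability.Probability"
begin

text \<open>
  Finite words over a set \<open>X\<close> of letters are the lists in \<open>lists X\<close>, infinite words the streams
  in \<open>streams X\<close>, and \<open>w @- \<zeta>\<close> is the concatenation of a finite and an infinite word.
\<close>

definition letters :: "nat \<Rightarrow> nat set" where
  "letters d = {0..<d}"

definition Cof :: "'a set \<Rightarrow> 'a stream \<Rightarrow> 'a stream set" where
  "Cof X \<xi> = {\<eta> \<in> streams X. finite {n. \<eta> !! n \<noteq> \<xi> !! n}}"

definition E2 :: "nat \<Rightarrow> nat stream set" where
  "E2 d = {w @- \<zeta> | w \<zeta>. w \<in> lists (letters d) \<and> \<zeta> \<in> streams {0, d - 1}}
     - Cof (letters d) (sconst (d - 1))"

definition E1 :: "nat \<Rightarrow> nat stream set" where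
  "E1 d = streams (letters d) - E2 d"

definition bernoulli :: "nat \<Rightarrow> nat stream measure" where
  "bernoulli d = stream_space (uniform_count_measure (letters d))"

lemma space_bernoulli: "space (bernoulli d) = streams (letters d)"
  by (simp add: bernoulli_def space_stream_space space_uniform_count_measure)

lemma prob_space_bernoulli:
  assumes "d \<ge> 1"
  shows "prob_space (bernoulli d)"
  unfolding bernoulli_def
  using assms
  by (intro prob_space.prob_space_stream_space prob_space_uniform_count_measure)
     (auto simp: letters_def)

lemma cylinder_Cons:
  "(@-) (x # w) ` streams X = {s. shd s = x \<and> stl s \<in> (@-) w ` streams X}"
proof (intro equalityI subsetI)
  fix s assume "s \<in> {s. shd s = x \<and> stl s \<in> (@-) w ` streams X}"
  then obtain t where "shd s = x" "stl s = w @- t" "t \<in> streams X"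
    by auto
  then have "s = (x # w) @- t"
    by (metis shift.simps(2) stream.collapse)
  with \<open>t \<in> streams X\<close> show "s \<in> (@-) (x # w) ` streams X"
    by blast
qed auto

lemma cylinder_measurable:
  assumes "w \<in> lists (letters d)"
  shows "(@-) w ` streams (letters d) \<in> sets (bernoulli d)"
  using assms
proof (induction w)
  case Nil
  then show ?case
    using sets.top[of "bernoulli d"] by (simp add: space_bernoulli)
next
  case (Cons x w)
  let ?U = "uniform_count_measure (letters d)"
  from Cons have x: "x \<in> letters d" and w: "w \<in> lists (letters d)"
    by auto
  have C: "(@-) w ` streams (letters d) \<in> sets (stream_space ?U)"
    using Cons.IH by (simp add: bernoulli_def)
  have [simp]: "{x} \<in> sets ?U"
    using x by (simp add: sets_uniform_count_measure)
  have 1: "shd -` {x} \<inter> space (stream_space ?U) \<in> sets (stream_space ?U)"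
    by (rule measurable_sets[OF measurable_shd]) simp
  have 2: "stl -` ((@-) w ` streams (letters d)) \<inter> space (stream_space ?U) \<in> sets (stream_space ?U)"
    by (rule measurable_sets[OF measurable_stl C])
  have "(@-) (x # w) ` streams (letters d) \<subseteq> streams (letters d)"
    using x w by (auto simp: streams_Stream intro!: shift_streams)
  then have "(@-) (x # w) ` streams (letters d) =
      (shd -` {x} \<inter> space (stream_space ?U)) \<inter>
      (stl -` ((@-) w ` streams (letters d)) \<inter> space (stream_space ?U))"
    unfolding cylinder_Cons space_stream_space space_uniform_count_measure by blast
  then show ?case
    unfolding bernoulli_def using sets.Int[OF 1 2] by metis
qed

lemma emeasure_bernoulli_cylinder:
  assumes d: "d \<ge> 1" and "w \<in> lists (letters d)"
  shows "emeasure (bernoulli d) ((@-) w ` streams (letters d)) = ennreal (1 / real d ^ length w)"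
  using assms(2)
proof (induction w)
  case Nil
  then show ?case
    using prob_space.emeasure_space_1[OF prob_space_bernoulli[OF d]] by (simp add: space_bernoulli)
next
  case (Cons x w)
  let ?U = "uniform_count_measure (letters d)"
  let ?C = "\<lambda>w. (@-) w ` streams (letters d)"
  from Cons have x: "x \<in> letters d" and w: "w \<in> lists (letters d)"
    by auto
  have fin: "finite (letters d)" and card: "card (letters d) = d"
    by (auto simp: letters_def)
  interpret U: prob_space ?U
    using d by (intro prob_space_uniform_count_measure) (auto simp: letters_def)
  have meas: "?C (x # w) \<in> sets (stream_space ?U)"
    using cylinder_measurable[of "x # w" d] x w by (simp add: bernoulli_def)
  have "emeasure (stream_space ?U) (?C (x # w)) =
      (\<integral>\<^sup>+t. emeasure (stream_space ?U) {s \<in> space (stream_space ?U). t ## s \<in> ?C (x # w)} \<partial>?U)"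
    by (rule U.emeasure_stream_space[OF meas])
  also have "\<dots> = (\<integral>\<^sup>+t. emeasure (stream_space ?U) (?C w) * indicator {x} t \<partial>?U)"
  proof (rule nn_integral_cong)
    fix t
    have "{s \<in> space (stream_space ?U). t ## s \<in> ?C (x # w)} = (if t = x then ?C w else {})"
      using w unfolding cylinder_Cons
      by (auto simp: space_stream_space space_uniform_count_measure intro!: shift_streams)
    then show "emeasure (stream_space ?U) {s \<in> space (stream_space ?U). t ## s \<in> ?C (x # w)}
        = emeasure (stream_space ?U) (?C w) * indicator {x} t"
      by (simp add: indicator_def)
  qed
  also have "\<dots> = emeasure (stream_space ?U) (?C w) * emeasure ?U {x}"
    using x by (subst nn_integral_cmult_indicator) (auto simp: sets_uniform_count_measure)
  also have "emeasure ?U {x} = ennreal (1 / real d)"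
    using x fin card by (simp add: emeasure_uniform_count_measure)
  also have "emeasure (stream_space ?U) (?C w) = ennreal (1 / real d ^ length w)"
    using Cons.IH by (simp add: bernoulli_def)
  also have "ennreal (1 / real d ^ length w) * ennreal (1 / real d) = ennreal (1 / real d ^ length (x # w))"
    by (simp add: ennreal_mult[symmetric] mult.commute)
  finally show ?case
    by (simp add: bernoulli_def)
qed

end

theory Submission
  imports Defs
begin

text \<open>
  For a set \<open>A\<close> of letters of probability \<open>p < 1\<close>, splitting off the first letter shows that
  the measure \<open>m\<close> of \<open>streams A\<close> satisfies \<open>m = p * m\<close>, so \<open>m = 0\<close>; the same holds for the
  words with a tail in \<open>streams A\<close>. For \<open>d \<ge> 3\<close> apply this to \<open>A = {0, d - 1}\<close>. For \<open>d = 2\<close>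
  the set \<open>E1 d\<close> is the cofinality class of a constant word, the case \<open>A = {d - 1}\<close>.
\<close>

lemma (in prob_space) streams_null_sets:
  assumes A: "A \<in> sets M" and less: "emeasure M A < 1"
  shows "streams A \<in> null_sets (stream_space M)"
proof -
  interpret S: prob_space "stream_space M"
    by (rule prob_space_stream_space)
  have meas: "streams A \<in> sets (stream_space M)"
    using A by (rule streams_sets)
  have sub: "streams A \<subseteq> space (stream_space M)"
    using sets.sets_into_space[OF meas] .
  let ?m = "emeasure (stream_space M) (streams A)"
  have "?m = (\<integral>\<^sup>+t. emeasure (stream_space M) {s \<in> space (stream_space M). t ## s \<in> streams A} \<partial>M)"
    by (rule emeasure_stream_space[OF meas])
  also have "\<dots> = (\<integral>\<^sup>+t. ?m * indicator A t \<partial>M)"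
  proof (rule nn_integral_cong)
    fix t
    have "{s \<in> space (stream_space M). t ## s \<in> streams A} = (if t \<in> A then streams A else {})"
      using sub by (auto simp: streams_Stream)
    then show "emeasure (stream_space M) {s \<in> space (stream_space M). t ## s \<in> streams A}
        = ?m * indicator A t"
      by simp
  qed
  also have "\<dots> = ?m * emeasure M A"
    using A by (rule nn_integral_cmult_indicator)
  \<comment> \<open>Finiteness of both measures moves the equation to the reals, where a factor
    below 1 forces measure 0; in \<open>ennreal\<close> the value \<infinity> could not be excluded
    this way.\<close>
  finally have "S.prob (streams A) = S.prob (streams A) * prob A"
    by (simp add: emeasure_eq_measure S.emeasure_eq_measure ennreal_mult[symmetric])
  moreover have "prob A < 1"
    using less by (simp add: emeasure_eq_measure)
  ultimately show ?thesis
    using meas by (simp add: null_sets_def S.emeasure_eq_measure)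
qed

text \<open>The shift preserves the product measure: integrating out the first letter reduces the
  preimage under \<open>sdrop (Suc n)\<close> to the one under \<open>sdrop n\<close>.\<close>

lemma (in prob_space) sdrop_null_sets:
  assumes "B \<in> null_sets (stream_space M)"
  shows "{s \<in> space (stream_space M). sdrop n s \<in> B} \<in> null_sets (stream_space M)"
proof (induction n)
  case 0
  have "B \<subseteq> space (stream_space M)"
    using assms sets.sets_into_space by blast
  then have "{s \<in> space (stream_space M). sdrop 0 s \<in> B} = B"
    by auto
  with assms show ?case
    by simp
next
  case (Suc n)
  let ?N = "\<lambda>n. {s \<in> space (stream_space M). sdrop n s \<in> B}"
  have [measurable]: "B \<in> sets (stream_space M)"
    using assms by blast
  have meas: "?N (Suc n) \<in> sets (stream_space M)"
    by measurable
  have "emeasure (stream_space M) (?N (Suc n)) =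
      (\<integral>\<^sup>+t. emeasure (stream_space M) {s \<in> space (stream_space M). t ## s \<in> ?N (Suc n)} \<partial>M)"
    by (rule emeasure_stream_space[OF meas])
  also have "\<dots> = (\<integral>\<^sup>+t. emeasure (stream_space M) (?N n) \<partial>M)"
  proof (rule nn_integral_cong)
    fix t assume "t \<in> space M"
    then have "{s \<in> space (stream_space M). t ## s \<in> ?N (Suc n)} = ?N n"
      by (auto simp: space_stream_space streams_Stream)
    then show "emeasure (stream_space M) {s \<in> space (stream_space M). t ## s \<in> ?N (Suc n)}
        = emeasure (stream_space M) (?N n)"
      by simp
  qed
  also have "\<dots> = 0"
    using Suc.IH by (simp add: null_sets_def)
  finally show ?case
    using meas by blast
qed

text \<open>A common form for both sets that make up \<open>E2\<close>. Using \<open>sdrop\<close>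
  instead of a prefix word exhibits it as a countable union of shift preimages of
  \<open>streams A\<close>.\<close>

definition tail_in :: "'a set \<Rightarrow> 'a set \<Rightarrow> 'a stream set" where
  "tail_in X A = {s \<in> streams X. \<exists>n. sdrop n s \<in> streams A}"

lemma shift_streams_eq_tail_in:
  assumes "A \<subseteq> X"
  shows "{w @- \<zeta> | w \<zeta>. w \<in> lists X \<and> \<zeta> \<in> streams A} = tail_in X A"
proof (intro equalityI subsetI)
  fix s assume "s \<in> {w @- \<zeta> | w \<zeta>. w \<in> lists X \<and> \<zeta> \<in> streams A}"
  then obtain w z where "s = w @- z" "w \<in> lists X" "z \<in> streams A"
    by blast
  moreover have "sdrop (length w) (w @- z) = z"
    by (simp add: sdrop_shift)
  ultimately show "s \<in> tail_in X A"
    using assms streams_mono[of z A X] unfolding tail_in_def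
    by (auto intro!: shift_streams exI[of _ "length w"])
next
  fix s assume "s \<in> tail_in X A"
  then obtain n where s: "s \<in> streams X" and n: "sdrop n s \<in> streams A"
    by (auto simp: tail_in_def)
  \<comment> \<open>The first n letters of s serve as the prefix w.\<close>
  have "stake n s \<in> lists X"
    using s by (auto simp: in_set_conv_nth streams_iff_snth)
  with n show "s \<in> {w @- \<zeta> | w \<zeta>. w \<in> lists X \<and> \<zeta> \<in> streams A}"
    using stake_sdrop[of n s] by (metis (mono_tags, lifting) mem_Collect_eq)
qed

text \<open>Finitely many deviations from a means that from some position on every letter is a, and
  \<open>streams {a}\<close> holds only the constant word.\<close>

lemma Cof_sconst_eq_tail_in: "Cof X (sconst a) = tail_in X {a}"
proof -
  have "finite {n. s !! n \<noteq> a} \<longleftrightarrow> (\<exists>n. sdrop n s \<in> streams {a})" for s :: "'a stream"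
  proof -
    have "finite {n. s !! n \<noteq> a} \<longleftrightarrow> (\<exists>n. \<forall>i\<ge>n. s !! i = a)"
      using MOST_nat_le[of "\<lambda>i. s !! i = a"]
      by (simp add: eventually_cofinite flip: cofinite_eq_sequentially)
    also have "\<dots> \<longleftrightarrow> (\<exists>n. \<forall>i. s !! (n + i) = a)"
      by (metis le_add1 le_iff_add)
    finally show ?thesis
      by (simp add: streams_iff_snth sdrop_snth)
  qed
  then show ?thesis
    by (simp add: Cof_def tail_in_def)
qed

text \<open>A proper subset of the alphabet has uniform probability below 1, so
  \<open>streams A\<close> is null, and so is the countable union of its preimages under all
  \<open>sdrop n\<close>.\<close>

lemma tail_in_null_sets:
  assumes "A \<subset> letters d"
  shows "tail_in (letters d) A \<in> null_sets (bernoulli d)"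
proof -
  let ?U = "uniform_count_measure (letters d)"
  have fin: "finite (letters d)" and ne: "letters d \<noteq> {}"
    using assms by (auto simp: letters_def)
  interpret U: prob_space ?U
    using fin ne by (rule prob_space_uniform_count_measure)
  have "card A < card (letters d)"
    using fin assms by (rule psubset_card_mono)
  then have "emeasure ?U A < 1"
    using fin assms by (simp add: emeasure_uniform_count_measure psubset_imp_subset)
  moreover have "A \<in> sets ?U"
    using assms by (auto simp: sets_uniform_count_measure)
  ultimately have "streams A \<in> null_sets (bernoulli d)"
    unfolding bernoulli_def by (intro U.streams_null_sets)
  then have "(\<Union>n. {s \<in> space (bernoulli d). sdrop n s \<in> streams A}) \<in> null_sets (bernoulli d)"
    unfolding bernoulli_def by (intro null_sets_UN U.sdrop_null_sets)
  also have "(\<Union>n. {s \<in> space (bernoulli d). sdrop n s \<in> streams A}) = tail_in (letters d) A"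
    by (auto simp: tail_in_def space_bernoulli)
  finally show ?thesis .
qed

lemma (in prob_space) emeasure_compl_null_set:
  assumes "N \<in> null_sets M"
  shows "emeasure M (space M - N) = 1"
  using assms by (simp add: emeasure_compl null_sets_def emeasure_space_1)

theorem theorem6p3:
  fixes d :: nat
  assumes "d \<ge> 2"
  shows "(d = 2 \<longrightarrow> emeasure (bernoulli d) (E1 d) = 0 \<and> emeasure (bernoulli d) (E2 d) = 1)
    \<and> (d \<ge> 3 \<longrightarrow> emeasure (bernoulli d) (E1 d) = 1 \<and> emeasure (bernoulli d) (E2 d) = 0)"
proof -
  let ?X = "letters d"
  interpret prob_space "bernoulli d"
    using assms by (intro prob_space_bernoulli) simp
  have E2: "E2 d = tail_in ?X {0, d - 1} - tail_in ?X {d - 1}"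
    unfolding E2_def Cof_sconst_eq_tail_in
    using assms by (subst shift_streams_eq_tail_in) (auto simp: letters_def)
  have E1: "E1 d = space (bernoulli d) - E2 d"
    by (simp add: E1_def space_bernoulli)
  have null1: "tail_in ?X {d - 1} \<in> null_sets (bernoulli d)"
  proof (rule tail_in_null_sets)
    \<comment> \<open>The letter 0 differs from d - 1 because d \<ge> 2.\<close>
    have "0 \<in> ?X - {d - 1}" "d - 1 \<in> ?X"
      using assms by (auto simp: letters_def)
    then show "{d - 1} \<subset> ?X"
      by blast
  qed
  show ?thesis
  proof (intro conjI impI)
    assume "d = 2"
    \<comment> \<open>The two letters now exhaust the alphabet, so n = 0 works for every word and
      \<open>E2 d\<close> is the complement of a null set.\<close>
    then have "?X = {0, d - 1}"
      by (auto simp: letters_def)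
    then have "tail_in ?X {0, d - 1} = space (bernoulli d)"
      by (auto simp: tail_in_def space_bernoulli intro: exI[of _ 0])
    then have E2': "E2 d = space (bernoulli d) - tail_in ?X {d - 1}"
      using E2 by simp
    then have "E1 d = tail_in ?X {d - 1}"
      using E1 by (auto simp: tail_in_def space_bernoulli)
    then show "emeasure (bernoulli d) (E1 d) = 0"
      using null1 by auto
    show "emeasure (bernoulli d) (E2 d) = 1"
      unfolding E2' using null1 by (rule emeasure_compl_null_set)
  next
    assume "d \<ge> 3"
    have "{0, d - 1} \<subset> ?X"
    proof -
      \<comment> \<open>From d \<ge> 3 on, the letter 1 is distinct from d - 1.\<close>
      have "1 \<in> ?X - {0, d - 1}" "{0, d - 1} \<subseteq> ?X"
        using \<open>d \<ge> 3\<close> by (auto simp: letters_def)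
      then show ?thesis
        by blast
    qed
    \<comment> \<open>A null set minus a measurable set is null; \<open>null1\<close> supplies the
      measurability.\<close>
    then have E2_null: "E2 d \<in> null_sets (bernoulli d)"
      unfolding E2 using null1 by (intro null_set_Diff tail_in_null_sets) auto
    then show "emeasure (bernoulli d) (E2 d) = 0"
      by blast
    show "emeasure (bernoulli d) (E1 d) = 1"
      unfolding E1 using E2_null by (rule emeasure_compl_null_set)
  qed
qed

end
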